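(* Let $X$ be a two-sided shift space on a finite alphabet. If $\varphi\equiv0$, then the unstable leaf measures $m^{\mathrm u}_x$ have uniformly continuous holonomies on the family of all rectangles.
   Context: Let $A$ be a finite set and $\sigma\colon A^{\mathbb Z}\to A^{\mathbb Z}$ the shift $(\sigma x)_n=x_{n+1}$; $A^{\mathbb Z}$ has the metric $d(x,y)=2^{-\min\{|n|:x_n\ne y_n\}}$. A two-sided shift space is a (nonempty) closed $\sigma$-invariant set $X\subset A^{\mathbb Z}$. For $w\in A^n$ (length $|w|=n$) let $[w]^+=\{x\in X:x_{[0,n)}=w\}$; $\mathcal L_n=\{w\in A^n:[w]^+\ne\emptyset\}$, $\mathcal L=\bigcup_{n\ge0}\mathcal L_n$, $\mathcal L_{\ge N}=\{w\in\mathcal L:|w|\ge N\}$. For a continuous potential $\varphi\colon X\to\mathbb R$ let $S_n\varphi(x)=\sum_{k=0}^{n-1}\varphi(\sigma^kx)$, $\Phi(w)=\sup_{x\in[w]^+}S_{|w|}\varphi(x)$, $\Lambda_n=\sum_{w\in\mathcal L_n}e^{\Phi(w)}$, $P=\lim_n\frac1n\log\Lambda_n$. Unstable leaves and leaf measures: $W^{\mathrm u}_{\mathrm{loc}}(x)=\{y\in X:y_k=x_k\ \forall k\le0\}$; $\Phi^+_x(w)=\sup\{S_{|w|}\varphi(y):y\in W^{\mathrm u}_{\mathrm{loc}}(x)\cap[w]^+\}$ ($\sup\emptyset=-\infty$, $e^{-\infty}=0$); $\mathbb E^+(Z,N)=\{\mathcal E\subset\mathcal L_{\ge N}:Z\subset\bigcup_{w\in\mathcal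 E}[w]^+\}$; $$m^{\mathrm u}_x(Z)=\lim_{N\to\infty}\inf\Big\{\sum_{w\in\mathcal E}e^{\Phi^+_x(w)-|w|P}:\mathcal E\in\mathbb E^+(Z,N)\Big\}\quad(Z\subset W^{\mathrm u}_{\mathrm{loc}}(x)),$$ which is a Borel measure on $W^{\mathrm u}_{\mathrm{loc}}(x)$. Rectangles and holonomies: for $x,y\in X$ with $x_0=y_0$, $[x,y]$ is the sequence with $[x,y]_n=x_n$ for $n\le0$ and $[x,y]_n=y_n$ for $n\ge0$. A set $R\subset X$ is a rectangle if for all $x,y\in R$ the bracket $[x,y]$ is defined (so $x_0=y_0$) and lies in $R$. For $x\in R$, $W^{\mathrm u}_R(x)=W^{\mathrm u}_{\mathrm{loc}}(x)\cap R$. For $z,y\in R$ the stable holonomy $\pi^s_{z,y}\colon W^{\mathrm u}_R(z)\to W^{\mathrm u}_R(y)$ is $\pi^s_{z,y}(x)=[y,x]$. The leaf measures $m^{\mathrm u}_x$ have uniformly continuous holonomies on a collection $\mathcal R$ of rectangles if for every $\epsilon>0$ there is $\delta>0$ such that for all $R\in\mathcal R$ and $y,z\in R$ with $d(y,z)<\delta$ we have $e^{-\epsilon}m^{\mathrm u}_z(\pi^s_{y,z}(Y))\le m^{\mathrm u}_y(Y)\le e^{\epsilon}m^{\mathrm u}_z(\pi^s_{y,z}(Y))$ for all measurable $Y\subset W^{\mathrm u}_R(y)$. *)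

theory Defs
  imports "HOL-Analysis.Analysis"
begin

section \<open>Two-sided shift spaces\<close>

text \<open>
  The alphabet is a type of class \<^class>\<open>finite\<close>; bi-infinite sequences are functions
  on the integers, and words are lists.
\<close>

definition shift :: "(int \<Rightarrow> 'a) \<Rightarrow> (int \<Rightarrow> 'a)" where
  "shift x = (\<lambda>n. x (n + 1))"

definition seq_dist :: "(int \<Rightarrow> 'a) \<Rightarrow> (int \<Rightarrow> 'a) \<Rightarrow> real" where
  "seq_dist x y = (if x = y then 0 else (1 / 2) ^ (LEAST k. \<exists>n. nat \<bar>n\<bar> = k \<and> x n \<noteq> y n))"

lemma seq_dist_le_iff:
  assumes "x \<noteq> y"
  shows "seq_dist x y \<le> (1 / 2) ^ k \<longleftrightarrow> (\<forall>n. nat \<bar>n\<bar> < k \<longrightarrow> x n = y n)"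
proof -
  let ?P = "\<lambda>k. \<exists>n. nat \<bar>n\<bar> = k \<and> x n \<noteq> y n"
  obtain m where "x m \<noteq> y m" using assms by blast
  then have ex: "?P (nat \<bar>m\<bar>)" by blast
  have "seq_dist x y \<le> (1 / 2) ^ k \<longleftrightarrow> k \<le> (LEAST k. ?P k)"
    using assms by (simp add: seq_dist_def power_decreasing_iff)
  also have "\<dots> \<longleftrightarrow> (\<forall>j. ?P j \<longrightarrow> k \<le> j)"
  proof
    assume "k \<le> (LEAST k. ?P k)"
    then show "\<forall>j. ?P j \<longrightarrow> k \<le> j" by (blast intro: le_trans Least_le[of ?P])
  next
    assume "\<forall>j. ?P j \<longrightarrow> k \<le> j"
    with LeastI[of ?P, OF ex] show "k \<le> (LEAST k. ?P k)" by simp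
  qed
  also have "\<dots> \<longleftrightarrow> (\<forall>n. nat \<bar>n\<bar> < k \<longrightarrow> x n = y n)"
    using not_le by blast
  finally show ?thesis .
qed

lemma seq_dist_ultra: "seq_dist x z \<le> max (seq_dist x y) (seq_dist y z)"
proof (cases "x = y \<or> y = z \<or> x = z")
  case True
  then show ?thesis by (auto simp: seq_dist_def le_max_iff_disj)
next
  case False
  obtain i j where ij: "seq_dist x y = (1 / 2) ^ i" "seq_dist y z = (1 / 2) ^ j"
    using False by (auto simp: seq_dist_def)
  have "\<forall>n. nat \<bar>n\<bar> < i \<longrightarrow> x n = y n" "\<forall>n. nat \<bar>n\<bar> < j \<longrightarrow> y n = z n"
    using seq_dist_le_iff[of x y i] seq_dist_le_iff[of y z j] False ij by auto
  then have "seq_dist x z \<le> (1 / 2) ^ min i j"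
    using seq_dist_le_iff[of x z "min i j"] False by auto
  also have "\<dots> \<le> max (seq_dist x y) (seq_dist y z)"
    unfolding ij by (cases "i \<le> j") (auto simp: min_def)
  finally show ?thesis .
qed

lemma Metric_space_seq_dist: "Metric_space UNIV seq_dist"
proof
  show nn: "0 \<le> seq_dist x y" for x y :: "int \<Rightarrow> 'a" by (simp add: seq_dist_def)
  show "seq_dist x y = seq_dist y x" for x y :: "int \<Rightarrow> 'a"
    by (simp add: seq_dist_def eq_commute[of x y] eq_commute[of "x _" "y _"])
  show "seq_dist x y = 0 \<longleftrightarrow> x = y" for x y :: "int \<Rightarrow> 'a" by (simp add: seq_dist_def)
  show "seq_dist x z \<le> seq_dist x y + seq_dist y z" for x y z :: "int \<Rightarrow> 'a"
    using seq_dist_ultra[of x z y] nn[of x y] nn[of y z] by linarith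
qed

abbreviation seq_topology :: "(int \<Rightarrow> 'a) topology" where
  "seq_topology \<equiv> Metric_space.mtopology UNIV seq_dist"

definition shift_space :: "(int \<Rightarrow> 'a::finite) set \<Rightarrow> bool" where
  "shift_space X \<longleftrightarrow> X \<noteq> {} \<and> closedin seq_topology X \<and> shift ` X = X"

definition cylinder :: "(int \<Rightarrow> 'a) set \<Rightarrow> 'a list \<Rightarrow> (int \<Rightarrow> 'a) set" where
  "cylinder X w = {x \<in> X. \<forall>i<length w. x (int i) = w ! i}"

definition lang :: "(int \<Rightarrow> 'a) set \<Rightarrow> 'a list set" where
  "lang X = {w. cylinder X w \<noteq> {}}"

definition lang_eq :: "(int \<Rightarrow> 'a) set \<Rightarrow> nat \<Rightarrow> 'a list set" where
  "lang_eq X n = {w \<in> lang X. length w = n}"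

definition lang_ge :: "(int \<Rightarrow> 'a) set \<Rightarrow> nat \<Rightarrow> 'a list set" where
  "lang_ge X N = {w \<in> lang X. length w \<ge> N}"


section \<open>Potentials and pressure\<close>

text \<open>
  A potential on \<open>X\<close> is represented by a function on all bi-infinite sequences;
  for shift-invariant \<open>X\<close> only its values on \<open>X\<close> enter the definitions below.
\<close>

definition birkhoff_sum ::
    "((int \<Rightarrow> 'a) \<Rightarrow> real) \<Rightarrow> nat \<Rightarrow> (int \<Rightarrow> 'a) \<Rightarrow> real" where
  "birkhoff_sum \<phi> n x = (\<Sum>k<n. \<phi> ((shift ^^ k) x))"

definition word_sup ::
    "(int \<Rightarrow> 'a) set \<Rightarrow> ((int \<Rightarrow> 'a) \<Rightarrow> real) \<Rightarrow> 'a list \<Rightarrow> real" where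
  "word_sup X \<phi> w = (SUP x\<in>cylinder X w. birkhoff_sum \<phi> (length w) x)"

definition partition_sum ::
    "(int \<Rightarrow> 'a::finite) set \<Rightarrow> ((int \<Rightarrow> 'a) \<Rightarrow> real) \<Rightarrow> nat \<Rightarrow> real" where
  "partition_sum X \<phi> n = (\<Sum>w\<in>lang_eq X n. exp (word_sup X \<phi> w))"

definition pressure :: "(int \<Rightarrow> 'a::finite) set \<Rightarrow> ((int \<Rightarrow> 'a) \<Rightarrow> real) \<Rightarrow> real" where
  "pressure X \<phi> = lim (\<lambda>n. (1 / real n) * ln (partition_sum X \<phi> n))"


section \<open>Unstable leaves and leaf measures\<close>

definition W_u_loc :: "(int \<Rightarrow> 'a) set \<Rightarrow> (int \<Rightarrow> 'a) \<Rightarrow> (int \<Rightarrow> 'a) set" where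
  "W_u_loc X x = {y \<in> X. \<forall>k\<le>0. y k = x k}"

text \<open>The supremum is taken in \<^typ>\<open>ereal\<close>, so that it is \<open>-\<infinity>\<close> over the empty set.\<close>

definition leaf_word_sup ::
    "(int \<Rightarrow> 'a) set \<Rightarrow> ((int \<Rightarrow> 'a) \<Rightarrow> real) \<Rightarrow> (int \<Rightarrow> 'a) \<Rightarrow> 'a list \<Rightarrow> ereal" where
  "leaf_word_sup X \<phi> x w =
     (SUP y \<in> W_u_loc X x \<inter> cylinder X w. ereal (birkhoff_sum \<phi> (length w) y))"

definition ereal_exp :: "ereal \<Rightarrow> ennreal" where
  "ereal_exp a =
     (case a of ereal r \<Rightarrow> ennreal (exp r) | PInfty \<Rightarrow> \<infinity> | MInfty \<Rightarrow> 0)"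

definition word_covers ::
    "(int \<Rightarrow> 'a) set \<Rightarrow> (int \<Rightarrow> 'a) set \<Rightarrow> nat \<Rightarrow> 'a list set set" where
  "word_covers X Z N = {E. E \<subseteq> lang_ge X N \<and> Z \<subseteq> (\<Union>w\<in>E. cylinder X w)}"

text \<open>
  Covers may be infinite, hence the unordered infinite sum in \<^typ>\<open>ennreal\<close>, which exists
  for every family.
\<close>

definition leaf_measure ::
    "(int \<Rightarrow> 'a::finite) set \<Rightarrow> ((int \<Rightarrow> 'a) \<Rightarrow> real) \<Rightarrow> (int \<Rightarrow> 'a) \<Rightarrow> (int \<Rightarrow> 'a) set \<Rightarrow> ennreal"
  where
  "leaf_measure X \<phi> x Z = lim (\<lambda>N. INF E\<in>word_covers X Z N.
     \<Sum>\<^sub>\<infinity>w\<in>E. ereal_exp (leaf_word_sup X \<phi> x w - ereal (real (length w) * pressure X \<phi>)))"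

definition leaf_borel_sets ::
    "(int \<Rightarrow> 'a) set \<Rightarrow> (int \<Rightarrow> 'a) \<Rightarrow> (int \<Rightarrow> 'a) set set" where
  "leaf_borel_sets X x =
     sigma_sets (W_u_loc X x) {U. openin (subtopology seq_topology (W_u_loc X x)) U}"


section \<open>Rectangles and holonomies\<close>

text \<open>The bracket is only meaningful if \<open>x 0 = y 0\<close>.\<close>

definition bracket :: "(int \<Rightarrow> 'a) \<Rightarrow> (int \<Rightarrow> 'a) \<Rightarrow> (int \<Rightarrow> 'a)" where
  "bracket x y = (\<lambda>n. if n \<le> 0 then x n else y n)"

definition rectangle :: "(int \<Rightarrow> 'a) set \<Rightarrow> (int \<Rightarrow> 'a) set \<Rightarrow> bool" where
  "rectangle X R \<longleftrightarrow> R \<subseteq> X \<and> (\<forall>x\<in>R. \<forall>y\<in>R. x 0 = y 0 \<and> bracket x y \<in> R)"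

definition W_u_rect ::
    "(int \<Rightarrow> 'a) set \<Rightarrow> (int \<Rightarrow> 'a) set \<Rightarrow> (int \<Rightarrow> 'a) \<Rightarrow> (int \<Rightarrow> 'a) set" where
  "W_u_rect X R x = W_u_loc X x \<inter> R"

text \<open>
  The map from the leaf of \<open>z\<close> to the leaf of \<open>y\<close>. The source point \<open>z\<close> only determines the
  domain, so it does not occur on the right-hand side.
\<close>

definition stable_holonomy ::
    "(int \<Rightarrow> 'a) \<Rightarrow> (int \<Rightarrow> 'a) \<Rightarrow> (int \<Rightarrow> 'a) \<Rightarrow> (int \<Rightarrow> 'a)" where
  "stable_holonomy z y x = bracket y x"

text \<open>
  The measurable subsets of \<open>W_u_rect X R y\<close> are the Borel subsets of the leaf \<open>W_u_loc X y\<close>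
  that are contained in it. The rectangle itself need not be Borel.
\<close>

definition uniformly_continuous_holonomies ::
    "(int \<Rightarrow> 'a::finite) set \<Rightarrow> ((int \<Rightarrow> 'a) \<Rightarrow> real) \<Rightarrow> (int \<Rightarrow> 'a) set set \<Rightarrow> bool" where
  "uniformly_continuous_holonomies X \<phi> \<R> \<longleftrightarrow>
     (\<forall>\<epsilon>::real. \<epsilon> > 0 \<longrightarrow> (\<exists>\<delta>::real. \<delta> > 0 \<and>
       (\<forall>R\<in>\<R>. \<forall>y\<in>R. \<forall>z\<in>R. seq_dist y z < \<delta> \<longrightarrow>
         (\<forall>Y\<in>leaf_borel_sets X y. Y \<subseteq> W_u_rect X R y \<longrightarrow>
            ennreal (exp (- \<epsilon>)) * leaf_measure X \<phi> z (stable_holonomy y z ` Y)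
              \<le> leaf_measure X \<phi> y Y \<and>
            leaf_measure X \<phi> y Y
              \<le> ennreal (exp \<epsilon>) * leaf_measure X \<phi> z (stable_holonomy y z ` Y)))))"

end

theory Submission
  imports Defs
begin

text \<open>
  For the zero potential a word contributes \<open>exp (- |w| P)\<close> to a covering sum as soon as its
  cylinder meets the leaf, whichever leaf that is. Words whose cylinders miss \<open>Y\<close> can be dropped
  from a cover of \<open>Y\<close>; the remaining cylinders also meet and cover the image of \<open>Y\<close> under the
  holonomy, which keeps all nonnegative coordinates. Hence holonomies preserve the leaf measures
  exactly, and every \<open>\<delta>\<close> works.
\<close>

text \<open>Since \<open>\<phi>\<close> is only known to vanish on \<open>X\<close>, forward
  invariance is what keeps the orbit in its zero set.\<close>

lemma birkhoff_sum_eq_0: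
  assumes "shift ` X \<subseteq> X" "\<forall>x\<in>X. \<phi> x = 0" "x \<in> X"
  shows "birkhoff_sum \<phi> n x = 0"
proof -
  have "(shift ^^ k) x \<in> X" for k
    using assms(1,3) by (induction k) auto
  then show ?thesis
    using assms(2) by (simp add: birkhoff_sum_def)
qed

text \<open>Nonemptiness matters: over the empty set the supremum is minus infinity, and the word
  then has weight 0.\<close>

lemma leaf_word_sup_eq_0:
  assumes "shift ` X \<subseteq> X" "\<forall>x\<in>X. \<phi> x = 0"
    and "W_u_loc X x \<inter> cylinder X w \<noteq> {}"
  shows "leaf_word_sup X \<phi> x w = 0"
proof -
  have "leaf_word_sup X \<phi> x w = (SUP y \<in> W_u_loc X x \<inter> cylinder X w. 0)"
    unfolding leaf_word_sup_def
    by (intro SUP_cong) (auto simp: cylinder_def zero_ereal_def intro!: birkhoff_sum_eq_0[OF assms(1,2)])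
  then show ?thesis
    using assms(3) by simp
qed

lemma bracket_in_W_u_loc: "bracket z x \<in> X \<Longrightarrow> bracket z x \<in> W_u_loc X z"
  by (simp add: W_u_loc_def bracket_def)

text \<open>The bracket takes coordinate 0 from \<open>z\<close>, but the word already constrains
  that coordinate; hence \<open>x 0 = z 0\<close>.\<close>

lemma bracket_in_cylinder:
  assumes "x \<in> cylinder X w" "bracket z x \<in> X" "x 0 = z 0"
  shows "bracket z x \<in> cylinder X w"
  using assms by (auto simp: cylinder_def bracket_def)

text \<open>Only the bracket, not a rectangle, enters the hypotheses, so that the same statement
  applied to the image and \<open>bracket y\<close> yields the reverse inequality.\<close>

lemma covering_inf_bracket_le:
  assumes X: "shift ` X \<subseteq> X" and \<phi>: "\<forall>x\<in>X. \<phi> x = 0"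
    and Y: "Y \<subseteq> W_u_loc X y" and "y 0 = z 0"
    and "\<forall>x\<in>Y. bracket z x \<in> X"
  shows "(INF E\<in>word_covers X (bracket z ` Y) N.
            \<Sum>\<^sub>\<infinity>w\<in>E. ereal_exp (leaf_word_sup X \<phi> z w - ereal (real (length w) * p)))
       \<le> (INF E\<in>word_covers X Y N.
            \<Sum>\<^sub>\<infinity>w\<in>E. ereal_exp (leaf_word_sup X \<phi> y w - ereal (real (length w) * p)))"
    (is "(INF E\<in>_. infsum ?f E) \<le> (INF E\<in>_. infsum ?g E)")
proof (rule INF_mono)
  fix E assume E: "E \<in> word_covers X Y N"
  \<comment> \<open>A word of \<open>E\<close> missing \<open>Y\<close> could meet the leaf of
    \<open>z\<close> but not that of \<open>y\<close>, and would then cost more under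
    \<open>?f\<close> than under \<open>?g\<close>.\<close>
  define E' where "E' = {w \<in> E. Y \<inter> cylinder X w \<noteq> {}}"
  have br: "bracket z x \<in> X" if "x \<in> Y" for x
    using assms(5) that by blast
  have x0: "x 0 = z 0" if "x \<in> Y" for x
    using that Y \<open>y 0 = z 0\<close> by (auto simp: W_u_loc_def)
  have "\<exists>w\<in>E'. bracket z x \<in> cylinder X w" if x: "x \<in> Y" for x
  proof -
    obtain w where w: "w \<in> E" "x \<in> cylinder X w"
      using E x by (auto simp: word_covers_def)
    then show ?thesis
      using bracket_in_cylinder[OF w(2) br[OF x] x0[OF x]] x by (auto simp: E'_def)
  qed
  then have "E' \<in> word_covers X (bracket z ` Y) N"
    using E by (auto simp: word_covers_def E'_def)
  moreover have "?f w = ?g w" if w: "w \<in> E'" for w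
  proof -
    obtain x where x: "x \<in> Y" "x \<in> cylinder X w"
      using w by (auto simp: E'_def)
    then have "W_u_loc X y \<inter> cylinder X w \<noteq> {}" "W_u_loc X z \<inter> cylinder X w \<noteq> {}"
      using Y bracket_in_W_u_loc[OF br[OF x(1)]]
        bracket_in_cylinder[OF x(2) br[OF x(1)] x0[OF x(1)]] by blast+
    then show ?thesis
      by (simp add: leaf_word_sup_eq_0[OF X \<phi>])
  qed
  then have "infsum ?f E' \<le> infsum ?g E"
    by (intro infsum_mono_neutral) (auto simp: E'_def intro: nonneg_summable_on_complete)
  ultimately show "\<exists>E'\<in>word_covers X (bracket z ` Y) N. infsum ?f E' \<le> infsum ?g E"
    by blast
qed

lemma leaf_measure_stable_holonomy:
  assumes X: "shift ` X \<subseteq> X" and \<phi>: "\<forall>x\<in>X. \<phi> x = 0"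
    and R: "rectangle X R" "y \<in> R" "z \<in> R" and Y: "Y \<subseteq> W_u_rect X R y"
  shows "leaf_measure X \<phi> z (stable_holonomy y z ` Y) = leaf_measure X \<phi> y Y"
proof -
  have yz: "y 0 = z 0" and YX: "Y \<subseteq> X" and YW: "Y \<subseteq> W_u_loc X y"
    using R Y by (auto simp: rectangle_def W_u_rect_def)
  have br: "\<forall>x\<in>Y. bracket z x \<in> X"
    using R Y by (fastforce simp: rectangle_def W_u_rect_def)
  \<comment> \<open>On the leaf of \<open>y\<close>, the nonpositive coordinates overwritten by
    \<open>z\<close> are those of \<open>y\<close>, so they can be restored.\<close>
  have "bracket y (bracket z x) = x" if "x \<in> Y" for x
    using YW that by (fastforce simp: W_u_loc_def bracket_def)
  then have round_trip: "bracket y ` bracket z ` Y = Y"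
    by (force simp: image_image)
  have ZW: "bracket z ` Y \<subseteq> W_u_loc X z"
    using bracket_in_W_u_loc br by blast
  have br': "\<forall>x\<in>bracket z ` Y. bracket y x \<in> X"
    using round_trip YX by blast
  \<comment> \<open>The infima agree for each \<open>N\<close>, so the two sequences are equal and
    their \<open>lim\<close> coincide without any convergence argument.\<close>
  then show ?thesis
    unfolding leaf_measure_def stable_holonomy_def
    using covering_inf_bracket_le[OF X \<phi> YW yz br]
      covering_inf_bracket_le[OF X \<phi> ZW yz[symmetric] br', unfolded round_trip]
    by (intro arg_cong[where f = lim] ext antisym) blast+
qed

theorem proposition1p10:
  fixes X :: "(int \<Rightarrow> 'a::finite) set" and \<phi> :: "(int \<Rightarrow> 'a) \<Rightarrow> real"
  assumes "shift_space X"
    and "\<forall>x\<in>X. \<phi> x = 0"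
  shows "uniformly_continuous_holonomies X \<phi> {R. rectangle X R}"
proof -
  have X: "shift ` X \<subseteq> X"
    using assms(1) by (simp add: shift_space_def)
  have mult: "ennreal (exp (- \<epsilon>)) * m \<le> m" "m \<le> ennreal (exp \<epsilon>) * m"
    if "\<epsilon> > 0" for \<epsilon> :: real and m
    using that mult_right_mono[of "ennreal (exp (- \<epsilon>))" 1 m]
      mult_right_mono[of 1 "ennreal (exp \<epsilon>)" m]
    by (simp_all add: ennreal_le_1 ennreal_ge_1)
  show ?thesis
    unfolding uniformly_continuous_holonomies_def
  proof (intro allI impI exI[of _ 1] conjI ballI)
    fix \<epsilon> :: real and R y z Y
    assume "\<epsilon> > 0" "R \<in> {R. rectangle X R}" "y \<in> R" "z \<in> R" "Y \<subseteq> W_u_rect X R y"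
    then have "leaf_measure X \<phi> z (stable_holonomy y z ` Y) = leaf_measure X \<phi> y Y"
      using assms(2) by (intro leaf_measure_stable_holonomy[OF X]) auto
    with mult[OF \<open>\<epsilon> > 0\<close>]
    show "ennreal (exp (- \<epsilon>)) * leaf_measure X \<phi> z (stable_holonomy y z ` Y) \<le> leaf_measure X \<phi> y Y"
      and "leaf_measure X \<phi> y Y \<le> ennreal (exp \<epsilon>) * leaf_measure X \<phi> z (stable_holonomy y z ` Y)"
      by simp_all
  qed simp
qed

end
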